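(* Let $N\geq 2$, $1<p<N$, $p^\star:=\frac{Np}{N-p}$, and $1\leq q<p^\star$. Let $B_R(x_0)\subset\mathbb{R}^N$ denote the ball centered at $x_0$ and with radius $R>0$, and let $$\lambda_q(R):=\min\left\{\frac{\|\nabla u\|_{L^p(B_R(x_0))}^p}{\|u\|_{L^q(B_R(x_0))}^p}: u\in W_0^{1,p}(B_R(x_0))\setminus\{0\}\right\}.$$ Then $\lambda_q(R)\to 0$ as $R\to\infty$.
   Context: $W_0^{1,p}(B_R(x_0))$ is the usual Sobolev space (closure of $C_c^\infty(B_R(x_0))$ in $W^{1,p}(B_R(x_0))$). The minimum defining $\lambda_q(R)$ is attained because the embedding $W_0^{1,p}(B_R(x_0))\hookrightarrow L^q(B_R(x_0))$ is compact for $1\leq q<p^\star$. *)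

theory Defs
  imports "HOL-Analysis.Analysis"
begin

primrec Ck :: "nat \<Rightarrow> ('a::euclidean_space \<Rightarrow> real) \<Rightarrow> bool" where
  "Ck 0 f \<longleftrightarrow> continuous_on UNIV f"
| "Ck (Suc k) f \<longleftrightarrow>
     (\<forall>x. f differentiable (at x)) \<and> (\<forall>v. Ck k (\<lambda>x. frechet_derivative f (at x) v))"

definition test_functions :: "'a::euclidean_space set \<Rightarrow> ('a \<Rightarrow> real) set" where
  "test_functions \<Omega> =
     {\<phi>. (\<forall>k. Ck k \<phi>) \<and> compact (closure {x. \<phi> x \<noteq> 0}) \<and> closure {x. \<phi> x \<noteq> 0} \<subseteq> \<Omega>}"

definition in_Lp :: "'a::euclidean_space set \<Rightarrow> real \<Rightarrow> ('a \<Rightarrow> 'b::euclidean_space) \<Rightarrow> bool" where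
  "in_Lp \<Omega> p f \<longleftrightarrow> f \<in> borel_measurable (lebesgue_on \<Omega>) \<and>
     integrable (lebesgue_on \<Omega>) (\<lambda>x. norm (f x) powr p)"

definition Lp_norm :: "'a::euclidean_space set \<Rightarrow> real \<Rightarrow> ('a \<Rightarrow> 'b::euclidean_space) \<Rightarrow> real" where
  "Lp_norm \<Omega> p f = (LINT x|lebesgue_on \<Omega>. norm (f x) powr p) powr (1 / p)"

(* g is a weak gradient of u on \<Omega> lying in L^p. Sobolev functions and their gradients are
   represented by pointwise functions, determined only up to null sets; the gradient is
   therefore a relation rather than a function of u. *)
definition weak_gradient ::
    "'a::euclidean_space set \<Rightarrow> real \<Rightarrow> ('a \<Rightarrow> real) \<Rightarrow> ('a \<Rightarrow> 'a) \<Rightarrow> bool" where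
  "weak_gradient \<Omega> p u g \<longleftrightarrow> in_Lp \<Omega> p g \<and>
     (\<forall>\<phi>\<in>test_functions \<Omega>. \<forall>b\<in>Basis.
        (LINT x|lebesgue_on \<Omega>. u x * frechet_derivative \<phi> (at x) b)
          = - (LINT x|lebesgue_on \<Omega>. (g x \<bullet> b) * \<phi> x))"

definition W1 :: "'a::euclidean_space set \<Rightarrow> real \<Rightarrow> ('a \<Rightarrow> real) set" where
  "W1 \<Omega> p = {u. in_Lp \<Omega> p u \<and> (\<exists>g. weak_gradient \<Omega> p u g)}"

(* The W^{1,p} norm of u when g is its weak gradient. *)
definition W1_norm ::
    "'a::euclidean_space set \<Rightarrow> real \<Rightarrow> ('a \<Rightarrow> real) \<Rightarrow> ('a \<Rightarrow> 'a) \<Rightarrow> real" where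
  "W1_norm \<Omega> p u g = (Lp_norm \<Omega> p u powr p + Lp_norm \<Omega> p g powr p) powr (1 / p)"

(* Closure of the test functions in W^{1,p}. *)
definition W1_0 :: "'a::euclidean_space set \<Rightarrow> real \<Rightarrow> ('a \<Rightarrow> real) set" where
  "W1_0 \<Omega> p = {u \<in> W1 \<Omega> p. \<forall>\<epsilon>>0. \<exists>\<phi>\<in>test_functions \<Omega>. \<exists>h.
     weak_gradient \<Omega> p (\<lambda>x. u x - \<phi> x) h \<and> W1_norm \<Omega> p (\<lambda>x. u x - \<phi> x) h < \<epsilon>}"

(* Nonzero in the Sobolev space means not almost everywhere zero. Membership in L^q follows
   from the Sobolev embedding; it is stated so that no quotient uses the default value 0
   of a divergent integral. *)
definition rayleigh_quotients ::
    "'a::euclidean_space set \<Rightarrow> real \<Rightarrow> real \<Rightarrow> real set" where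
  "rayleigh_quotients \<Omega> p q =
     {Lp_norm \<Omega> p g powr p / Lp_norm \<Omega> q u powr p | u g.
        u \<in> W1_0 \<Omega> p \<and> \<not> (AE x in lebesgue_on \<Omega>. u x = 0) \<and>
        weak_gradient \<Omega> p u g \<and> in_Lp \<Omega> q u}"

(* For 1 < p < DIM('a), 1 \<le> q < p* and R > 0 the infimum is attained, by compactness of
   the embedding of W_0^{1,p} into L^q, so it is the minimum. *)
definition lambda_q :: "real \<Rightarrow> real \<Rightarrow> 'a::euclidean_space \<Rightarrow> real \<Rightarrow> real" where
  "lambda_q p q x0 R = Inf (rayleigh_quotients (ball x0 R) p q)"

end

theory Submission
  imports Defs
begin

text \<open>
The number \<open>lambda_q p q x0 R\<close> is an infimum of nonnegative quotients, so it suffices to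
exhibit, in each ball of radius \<open>R = 2 * r\<close>, one competitor whose quotient tends to zero. The
competitor is one fixed bump dilated to the scale \<open>r\<close>. Its gradient is of size \<open>1 / r\<close> and
ball volumes scale like \<open>r\<close> to the power \<open>N\<close>, so the numerator is of order
\<open>r powr (N - p)\<close> and the denominator of order \<open>r powr (N * p / q)\<close>. The exponent
\<open>N - p - N * p / q\<close> of the quotient is negative exactly when \<open>q < N * p / (N - p)\<close>. Crude
bounds on the two norms (\<open>norm_bump_gradient_le\<close>, \<open>bump_ge\<close>) already show this rate, so no
change of variables is performed; they are combined in \<open>rayleigh_quotient_of_bump\<close>.

What remains is that the bump is an admissible competitor. It is built from \<open>exp (- (1 / t))\<close>;
it is smooth because a family of explicit functions containing it is closed under directional
derivatives (\<open>bump_derivative_differentiable\<close>). Its classical gradient is a weak gradient by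
integration by parts, which rests on the vanishing of the integral of a directional derivative
of a compactly supported \<open>C\<^sup>1\<close> function (\<open>integral_directional_derivative_eq_0\<close>).
\<close>

section \<open>A smooth radial bump\<close>

text \<open>
The weight \<open>1 / t ^ j\<close> is carried along because the derivative of
\<open>exp (- (1 / t)) / t ^ j\<close> is a combination of functions of the same form with larger \<open>j\<close>:
the whole family is closed under differentiation.
\<close>
definition flat_exp :: "nat \<Rightarrow> real \<Rightarrow> real" where
  "flat_exp j t = (if t > 0 then exp (- (1 / t)) / t ^ j else 0)"

text \<open>
The exponential beats every power of \<open>1 / t\<close>. Since \<open>flat_exp j t / t = flat_exp (j + 1) t\<close>,
this one limit also gives the derivative of every member of the family at the origin.
\<close>
lemma flat_exp_tendsto_0: "(flat_exp j \<longlongrightarrow> 0) (at 0)"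
proof -
  have "((\<lambda>t::real. inverse t ^ j / exp (inverse t)) \<longlongrightarrow> 0) (at_right 0)"
    by (rule filterlim_compose[OF tendsto_power_div_exp_0 filterlim_inverse_at_top_right])
  moreover have "\<forall>\<^sub>F t in at_right 0. inverse t ^ j / exp (inverse t) = flat_exp j t"
    unfolding eventually_at_filter
    by (intro always_eventually) (auto simp: flat_exp_def exp_minus field_simps)
  ultimately have right: "(flat_exp j \<longlongrightarrow> 0) (at_right 0)"
    by (rule Lim_transform_eventually)
  have "\<forall>\<^sub>F t in at_left 0. 0 = flat_exp j t"
    unfolding eventually_at_filter by (intro always_eventually) (auto simp: flat_exp_def)
  then have "(flat_exp j \<longlongrightarrow> 0) (at_left 0)"
    using Lim_transform_eventually tendsto_const by blast
  with right show ?thesis by (simp add: filterlim_split_at)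
qed

lemma DERIV_flat_exp:
  "(flat_exp j has_real_derivative flat_exp (j + 2) t - real j * flat_exp (j + 1) t) (at t)"
proof (cases t "0::real" rule: linorder_cases)
  case less
  have "((\<lambda>_. 0) has_real_derivative flat_exp (j + 2) t - real j * flat_exp (j + 1) t) (at t)"
    using less by (auto simp: flat_exp_def)
  then show ?thesis
    by (rule has_field_derivative_transform_within_open[of _ _ _ "{..<0}"])
      (use less in \<open>auto simp: flat_exp_def\<close>)
next
  case equal
  have "((\<lambda>y. (flat_exp j y - flat_exp j 0) / (y - 0)) \<longlongrightarrow> 0) (at 0)"
  proof (rule Lim_transform_eventually[OF flat_exp_tendsto_0[of "Suc j"]])
    show "\<forall>\<^sub>F y in at 0. flat_exp (Suc j) y = (flat_exp j y - flat_exp j 0) / (y - 0)"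
      unfolding eventually_at_filter
      by (intro always_eventually) (auto simp: flat_exp_def)
  qed
  then show ?thesis
    using equal by (simp add: has_field_derivative_iff flat_exp_def)
next
  case greater
  have pow: "real j * t ^ (j - Suc 0) = real j * t ^ j / t"
    using greater by (cases j) auto
  have "((\<lambda>t. exp (- (1 / t)) / t ^ j) has_real_derivative
      (exp (- (1 / t)) * (1 / t\<^sup>2) * t ^ j - exp (- (1 / t)) * (real j * t ^ (j - Suc 0)))
        / (t ^ j * t ^ j)) (at t)"
    using greater by (auto intro!: derivative_eq_intros simp: power2_eq_square)
  also have "(exp (- (1 / t)) * (1 / t\<^sup>2) * t ^ j - exp (- (1 / t)) * (real j * t ^ (j - Suc 0)))
        / (t ^ j * t ^ j) = flat_exp (j + 2) t - real j * flat_exp (j + 1) t"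
    unfolding pow using greater by (simp add: flat_exp_def field_simps power2_eq_square)
  finally have "((\<lambda>t. exp (- (1 / t)) / t ^ j) has_real_derivative
      flat_exp (j + 2) t - real j * flat_exp (j + 1) t) (at t)" .
  then show ?thesis
    by (rule has_field_derivative_transform_within_open[of _ _ _ "{0<..}"])
      (use greater in \<open>auto simp: flat_exp_def\<close>)
qed

lemma flat_exp_nonneg: "0 \<le> flat_exp j t" by (simp add: flat_exp_def)

text \<open>
With \<open>y = 1 / t\<close> this is \<open>y\<^sup>2 exp (- y) \<le> 2\<close>, a consequence of the quadratic Taylor
bound for the exponential. It bounds the gradient of the bump, whose profile is
\<open>flat_exp 0\<close> with derivative \<open>flat_exp 2\<close>.
\<close>
lemma flat_exp_2_le: "flat_exp 2 t \<le> 2"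
proof (cases "t > 0")
  case True
  then have "1 + 1 / t + (1 / t)\<^sup>2 / 2 \<le> exp (1 / t)"
    by (intro exp_lower_Taylor_quadratic) simp
  moreover have "0 < 1 / t" using True by simp
  ultimately have "(1 / t)\<^sup>2 \<le> 2 * exp (1 / t)" by linarith
  then show ?thesis
    using True by (simp add: flat_exp_def exp_minus field_simps)
qed (simp add: flat_exp_def)

text \<open>
A class of functions large enough to contain the bump with all its iterated directional
derivatives, and small enough that membership alone yields differentiability. Differentiating
the profile produces a factor \<open>(x - x0) \<bullet> v\<close>, whence the last rule.
\<close>
inductive bump_derivative :: "'a::euclidean_space \<Rightarrow> real \<Rightarrow> ('a \<Rightarrow> real) \<Rightarrow> bool"
  for x0 c where
  flat_exp: "bump_derivative x0 c (\<lambda>x. flat_exp j (1 - c * ((x - x0) \<bullet> (x - x0))))"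
| add: "bump_derivative x0 c f \<Longrightarrow> bump_derivative x0 c g \<Longrightarrow> bump_derivative x0 c (\<lambda>x. f x + g x)"
| scale: "bump_derivative x0 c f \<Longrightarrow> bump_derivative x0 c (\<lambda>x. a * f x)"
| coord: "bump_derivative x0 c f \<Longrightarrow> bump_derivative x0 c (\<lambda>x. ((x - x0) \<bullet> v) * f x)"

lemma has_derivative_flat_exp_radial:
  fixes x0 :: "'a::euclidean_space"
  shows "((\<lambda>x. flat_exp j (1 - c * ((x - x0) \<bullet> (x - x0)))) has_derivative
    (\<lambda>v. (- 2 * c) * (((x - x0) \<bullet> v) *
       (flat_exp (j + 2) (1 - c * ((x - x0) \<bullet> (x - x0)))
        + (- real j) * flat_exp (j + 1) (1 - c * ((x - x0) \<bullet> (x - x0)))))) ) (at x)"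
proof -
  have inner: "((\<lambda>x. 1 - c * ((x - x0) \<bullet> (x - x0))) has_derivative (\<lambda>v. - 2 * c * ((x - x0) \<bullet> v))) (at x)"
    by (auto intro!: derivative_eq_intros simp: inner_commute algebra_simps)
  show ?thesis
    by (rule has_derivative_eq_rhs[OF DERIV_compose_FDERIV[OF DERIV_flat_exp inner]])
      (auto simp: algebra_simps)
qed

text \<open>
Closure of the class under directional derivatives. This replaces a separate treatment of
every order of differentiability: smoothness follows by a plain induction on the order.
\<close>
lemma bump_derivative_differentiable:
  assumes "bump_derivative x0 c f"
  shows "\<exists>f'. (\<forall>x. (f has_derivative f' x) (at x)) \<and> (\<forall>v. bump_derivative x0 c (\<lambda>x. f' x v))"
  using assms
proof induction
  case (flat_exp j)
  show ?case
    using has_derivative_flat_exp_radial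
    by (intro exI conjI allI, assumption | rule) (intro bump_derivative.intros)
next
  case (add f g)
  then obtain f' g' where
    "\<And>x. (f has_derivative f' x) (at x)" "\<And>v. bump_derivative x0 c (\<lambda>x. f' x v)"
    "\<And>x. (g has_derivative g' x) (at x)" "\<And>v. bump_derivative x0 c (\<lambda>x. g' x v)"
    by blast
  then show ?case
    by (intro exI[of _ "\<lambda>x v. f' x v + g' x v"])
      (auto intro: has_derivative_add bump_derivative.add)
next
  case (scale f a)
  then obtain f' where
    "\<And>x. (f has_derivative f' x) (at x)" "\<And>v. bump_derivative x0 c (\<lambda>x. f' x v)"
    by blast
  then show ?case
    by (intro exI[of _ "\<lambda>x v. a * f' x v"])
      (auto intro: has_derivative_mult_right bump_derivative.scale)
next
  case (coord f w)
  then obtain f' where f':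
    "\<And>x. (f has_derivative f' x) (at x)" "\<And>v. bump_derivative x0 c (\<lambda>x. f' x v)"
    by blast
  have "((\<lambda>x. ((x - x0) \<bullet> w) * f x) has_derivative
          (\<lambda>v. ((x - x0) \<bullet> w) * f' x v + (v \<bullet> w) * f x)) (at x)" for x
    by (auto intro!: derivative_eq_intros f')
  moreover have "bump_derivative x0 c (\<lambda>x. ((x - x0) \<bullet> w) * f' x v + (v \<bullet> w) * f x)" for v
    using f'(2) coord.hyps by (intro bump_derivative.add bump_derivative.coord bump_derivative.scale)
  ultimately show ?case
    by (intro exI[of _ "\<lambda>x v. ((x - x0) \<bullet> w) * f' x v + (v \<bullet> w) * f x"]) blast
qed

lemma bump_derivative_Ck:
  assumes "bump_derivative x0 c f"
  shows "Ck k f"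
  using assms
proof (induction k arbitrary: f)
  case 0
  then have "\<And>x. isCont f x"
    using bump_derivative_differentiable has_derivative_continuous by blast
  then show ?case by (simp add: continuous_at_imp_continuous_on)
next
  case (Suc k)
  then obtain f' where f': "\<And>x. (f has_derivative f' x) (at x)"
      "\<And>v. bump_derivative x0 c (\<lambda>x. f' x v)"
    using bump_derivative_differentiable by blast
  moreover have "frechet_derivative f (at x) = f' x" for x
    using f'(1) by (metis frechet_derivative_at)
  ultimately show ?case
    using Suc.IH by (auto simp: differentiable_def)
qed

section \<open>Integration by parts for compactly supported functions\<close>

lemma integral_lebesgue_on_eq_lborel:
  fixes f :: "'a::euclidean_space \<Rightarrow> real"
  assumes "f \<in> borel_measurable borel" and "\<Omega> \<in> sets borel" and "\<And>x. x \<notin> \<Omega> \<Longrightarrow> f x = 0"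
  shows "(LINT x|lebesgue_on \<Omega>. f x) = (LINT x|lborel. f x)"
    and "integrable (lebesgue_on \<Omega>) f \<longleftrightarrow> integrable lborel f"
proof -
  have ind: "(\<lambda>x. indicator \<Omega> x *\<^sub>R f x) = f"
    using assms(3) by (auto simp: fun_eq_iff indicator_def)
  have \<Omega>: "\<Omega> \<inter> space lebesgue \<in> sets lebesgue" using assms(2) by simp
  show "(LINT x|lebesgue_on \<Omega>. f x) = (LINT x|lborel. f x)"
    using assms(1) by (simp add: integral_restrict_space[OF \<Omega>] ind[simplified] integral_completion)
  show "integrable (lebesgue_on \<Omega>) f \<longleftrightarrow> integrable lborel f"
    using assms(1) by (simp add: integrable_restrict_space[OF \<Omega>] ind[simplified] integrable_completion)
qed

lemma integrable_continuous_compact_support: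
  fixes f :: "'a::euclidean_space \<Rightarrow> real"
  assumes "continuous_on UNIV f" and "compact K" and "\<And>x. x \<notin> K \<Longrightarrow> f x = 0"
  shows "integrable lborel f"
proof -
  have "(\<lambda>x. indicator K x *\<^sub>R f x) = f"
    using assms(3) by (auto simp: fun_eq_iff indicator_def)
  moreover have "integrable lborel (\<lambda>x. indicator K x *\<^sub>R f x)"
    using assms(2) continuous_on_subset[OF assms(1)] by (intro borel_integrable_compact) auto
  ultimately show ?thesis by simp
qed

lemma has_derivative_eq_0_off_support:
  fixes f :: "'a::euclidean_space \<Rightarrow> real"
  assumes "(f has_derivative f') (at x)" and "closed K" and "\<And>x. x \<notin> K \<Longrightarrow> f x = 0" and "x \<notin> K"
  shows "f' v = 0"
proof -
  have "((\<lambda>_. 0) has_derivative f') (at x)"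
    by (rule has_derivative_transform_within_open[OF assms(1), of "- K"]) (use assms in auto)
  then have "f' = (\<lambda>_. 0)" using has_derivative_unique has_derivative_const by blast
  then show ?thesis by simp
qed

lemma integral_lborel_translation:
  fixes f :: "'a::euclidean_space \<Rightarrow> real"
  assumes "f \<in> borel_measurable borel"
  shows "(LINT x|lborel. f (c + x)) = (LINT x|lborel. f x)"
    and "integrable lborel f \<Longrightarrow> integrable lborel (\<lambda>x. f (c + x))"
proof -
  have "(LINT x|distr lborel borel ((+) c). f x) = (LINT x|lborel. f (c + x))"
    using assms by (subst integral_distr) auto
  then show "(LINT x|lborel. f (c + x)) = (LINT x|lborel. f x)" by (simp add: lborel_distr_plus)
  have "integrable (distr lborel borel ((+) c)) f \<longleftrightarrow> integrable lborel (\<lambda>x. f (c + x))"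
    using assms by (subst integrable_distr_eq) auto
  then show "integrable lborel f \<Longrightarrow> integrable lborel (\<lambda>x. f (c + x))"
    by (simp add: lborel_distr_plus)
qed

lemma has_derivative_along_line:
  fixes f :: "'a::euclidean_space \<Rightarrow> real"
  assumes "(f has_derivative f') (at (t *\<^sub>R b + x))"
  shows "((\<lambda>t. f (t *\<^sub>R b + x)) has_real_derivative f' b) (at t)"
proof -
  have lin: "linear f'" using assms by (simp add: has_derivative_linear)
  have "((\<lambda>t. t *\<^sub>R b + x) has_derivative (\<lambda>h. h *\<^sub>R b)) (at t)"
    by (auto intro!: derivative_eq_intros)
  from has_derivative_compose[OF this assms]
  have "((\<lambda>t. f (t *\<^sub>R b + x)) has_derivative (\<lambda>h. f' (h *\<^sub>R b))) (at t)" .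
  then show ?thesis
    unfolding has_field_derivative_def
    by (rule has_derivative_eq_rhs) (simp add: fun_eq_iff linear_scale[OF lin])
qed

text \<open>
The integral of \<open>f\<close> is invariant under translation, so every difference quotient of \<open>f\<close> in
the direction \<open>b\<close> has integral zero. By the mean value theorem these quotients are bounded by
the supremum of the directional derivative, and they live on a common ball, so dominated
convergence passes to the limit.
\<close>
lemma integral_directional_derivative_eq_0:
  fixes f :: "'a::euclidean_space \<Rightarrow> real"
  assumes f': "\<And>x. (f has_derivative f' x) (at x)"
    and cont: "continuous_on UNIV (\<lambda>x. f' x b)"
    and K: "compact K" "\<And>x. x \<notin> K \<Longrightarrow> f x = 0"
  shows "(LINT x|lborel. f' x b) = 0"
proof -
  have f'_out: "f' x b = 0" if "x \<notin> K" for x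
    by (rule has_derivative_eq_0_off_support[OF f' compact_imp_closed[OF K(1)] K(2) that])
  have contf: "continuous_on UNIV f"
    using has_derivative_continuous[OF f'] by (simp add: continuous_at_imp_continuous_on)
  then have meas: "f \<in> borel_measurable borel" by (rule borel_measurable_continuous_onI)
  have intf: "integrable lborel f"
    by (rule integrable_continuous_compact_support[OF contf K])
  obtain M0 where M0: "\<And>x. x \<in> K \<Longrightarrow> \<bar>f' x b\<bar> \<le> M0"
    using compact_imp_bounded[OF compact_continuous_image[OF continuous_on_subset[OF cont] K(1)]]
    by (auto simp: bounded_iff)
  \<comment> \<open>The maximum with 0 covers an empty \<open>K\<close>, for which \<open>M0\<close> may be negative.\<close>
  define M where "M = max M0 0"
  have M: "\<bar>f' x b\<bar> \<le> M" for x
    using M0[of x] f'_out[of x] by (cases "x \<in> K") (auto simp: M_def)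
  obtain \<rho> where \<rho>: "\<And>x. x \<in> K \<Longrightarrow> norm x \<le> \<rho>"
    using compact_imp_bounded[OF K(1)] by (auto simp: bounded_iff)
  define h :: "nat \<Rightarrow> real" where "h n = 1 / real (Suc n)" for n
  have h: "0 < h n" "h n \<le> 1" for n by (auto simp: h_def)
  define D where "D n x = (f (h n *\<^sub>R b + x) - f x) / h n" for n x
  \<comment> \<open>Steps have length at most \<open>norm b\<close>, so the quotients vanish outside this enlarged ball.\<close>
  define w where "w = (\<lambda>x::'a. indicator (cball 0 (\<rho> + norm b)) x * M)"
  have D_bound: "\<bar>D n x\<bar> \<le> w x" for n x
  proof (cases "x \<in> cball 0 (\<rho> + norm b)")
    case True
    have "\<exists>z. 0 < z \<and> z < h n \<and>
        f (h n *\<^sub>R b + x) - f (0 *\<^sub>R b + x) = (h n - 0) * f' (z *\<^sub>R b + x) b"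
      by (rule MVT2[OF h(1)]) (rule has_derivative_along_line[OF f'])
    then obtain z where "f (h n *\<^sub>R b + x) - f x = h n * f' (z *\<^sub>R b + x) b" by auto
    then show ?thesis using True h(1)[of n] M by (simp add: D_def w_def)
  next
    case False
    then have nx: "norm x > \<rho> + norm b" by simp
    have "norm (h n *\<^sub>R b) \<le> norm b"
      using h[of n] by (simp add: mult_left_le_one_le)
    moreover have "norm x \<le> norm (h n *\<^sub>R b + x) + norm (h n *\<^sub>R b)"
      by (metis add_diff_cancel_left' norm_triangle_ineq4)
    ultimately have "norm (h n *\<^sub>R b + x) > \<rho>" using nx by linarith
    moreover have "norm x > \<rho>" using nx norm_ge_zero[of b] by linarith
    ultimately have "h n *\<^sub>R b + x \<notin> K" "x \<notin> K" using \<rho> by (meson not_le)+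
    then show ?thesis using K(2) False by (simp add: D_def w_def)
  qed
  have int_D: "(LINT x|lborel. D n x) = 0" for n
    using integral_lborel_translation[OF meas, of "h n *\<^sub>R b"] intf
    by (simp add: D_def)
  have lim_h: "h \<longlonglongrightarrow> 0"
    unfolding h_def using LIMSEQ_inverse_real_of_nat by (simp add: inverse_eq_divide)
  have lim_D: "(\<lambda>n. D n x) \<longlonglongrightarrow> f' x b" for x
  proof -
    have "((\<lambda>t. f (t *\<^sub>R b + x)) has_real_derivative f' x b) (at 0)"
      by (rule has_derivative_along_line) (use f' in simp)
    then have "((\<lambda>t. (f (t *\<^sub>R b + x) - f x) / t) \<longlongrightarrow> f' x b) (at 0)"
      by (simp add: has_field_derivative_iff)
    moreover have "filterlim h (at 0) sequentially"
      using lim_h h(1) by (intro filterlim_atI always_eventually) (auto simp: less_le)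
    ultimately show ?thesis
      unfolding D_def by (rule filterlim_compose)
  qed
  have "(\<lambda>n. LINT x|lborel. D n x) \<longlonglongrightarrow> (LINT x|lborel. f' x b)"
  proof (rule integral_dominated_convergence[where w = w])
    show "(\<lambda>x. f' x b) \<in> borel_measurable lborel"
      using cont by (simp add: borel_measurable_continuous_onI)
    show "D n \<in> borel_measurable lborel" for n
      unfolding D_def using meas by measurable
    have "integrable lborel (indicat_real (cball 0 (\<rho> + norm b) :: 'a set))"
      using emeasure_lborel_cball_finite[of "0::'a"] by (intro integrable_real_indicator) auto
    then show "integrable lborel w" unfolding w_def by simp
  qed (use lim_D D_bound in auto)
  then show ?thesis using int_D by (simp add: LIMSEQ_const_iff)
qed

lemma integration_by_parts_compact_support:
  fixes u \<phi> :: "'a::euclidean_space \<Rightarrow> real"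
  assumes u': "\<And>x. (u has_derivative u' x) (at x)" and cu': "continuous_on UNIV (\<lambda>x. u' x b)"
    and \<phi>': "\<And>x. (\<phi> has_derivative \<phi>' x) (at x)" and c\<phi>': "continuous_on UNIV (\<lambda>x. \<phi>' x b)"
    and K: "compact K" "\<And>x. x \<notin> K \<Longrightarrow> u x = 0"
  shows "(LINT x|lborel. u x * \<phi>' x b) = - (LINT x|lborel. u' x b * \<phi> x)"
proof -
  have cu: "continuous_on UNIV u" and c\<phi>: "continuous_on UNIV \<phi>"
    using has_derivative_continuous[OF u'] has_derivative_continuous[OF \<phi>']
    by (simp_all add: continuous_at_imp_continuous_on)
  have u'_out: "u' x b = 0" if "x \<notin> K" for x
    by (rule has_derivative_eq_0_off_support[OF u' compact_imp_closed[OF K(1)] K(2) that])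
  have "(LINT x|lborel. u x * \<phi>' x b + u' x b * \<phi> x) = 0"
    by (rule integral_directional_derivative_eq_0[of "\<lambda>x. u x * \<phi> x"
          "\<lambda>x v. u x * \<phi>' x v + u' x v * \<phi> x", OF has_derivative_mult[OF u' \<phi>'] _ K(1)])
      (auto intro!: continuous_intros cu c\<phi> cu' c\<phi>' simp: K(2))
  moreover have "integrable lborel (\<lambda>x. u x * \<phi>' x b)" "integrable lborel (\<lambda>x. u' x b * \<phi> x)"
    by (rule integrable_continuous_compact_support[OF _ K(1)];
        auto intro!: continuous_intros cu c\<phi> cu' c\<phi>' simp: K(2) u'_out)+
  ultimately show ?thesis by simp
qed

section \<open>Test functions as elements of the Sobolev space\<close>

lemma in_Lp_continuous_compact_support:
  fixes f :: "'a::euclidean_space \<Rightarrow> 'b::euclidean_space"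
  assumes f: "continuous_on UNIV f" and K: "compact K" "\<And>x. x \<notin> K \<Longrightarrow> f x = 0"
    and \<Omega>: "K \<subseteq> \<Omega>" "open \<Omega>" and "0 < p"
  shows "in_Lp \<Omega> p f"
proof -
  have "f \<in> borel_measurable (lebesgue_on \<Omega>)"
    using f \<Omega> by (intro continuous_imp_measurable_on_sets_lebesgue) (auto intro: continuous_on_subset)
  moreover have cont: "continuous_on UNIV (\<lambda>x. norm (f x) powr p)"
    using assms(6) by (intro continuous_on_powr' continuous_intros f) auto
  have "integrable lborel (\<lambda>x. norm (f x) powr p)"
    by (rule integrable_continuous_compact_support[OF cont K(1)]) (simp add: K(2))
  then have "integrable (lebesgue_on \<Omega>) (\<lambda>x. norm (f x) powr p)"
    using K(2) \<Omega> borel_measurable_continuous_onI[OF cont]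
    by (subst integral_lebesgue_on_eq_lborel) auto
  ultimately show ?thesis by (simp add: in_Lp_def)
qed

lemma test_functionsD:
  assumes "\<phi> \<in> test_functions \<Omega>"
  shows "(\<phi> has_derivative frechet_derivative \<phi> (at x)) (at x)"
    and "continuous_on UNIV (\<lambda>x. frechet_derivative \<phi> (at x) v)"
    and "compact (closure {x. \<phi> x \<noteq> 0})" and "closure {x. \<phi> x \<noteq> 0} \<subseteq> \<Omega>"
    and "x \<notin> closure {x. \<phi> x \<noteq> 0} \<Longrightarrow> \<phi> x = 0"
proof -
  have mem: "Ck k \<phi>" "compact (closure {x. \<phi> x \<noteq> 0})" "closure {x. \<phi> x \<noteq> 0} \<subseteq> \<Omega>" for k
    using assms by (simp_all only: test_functions_def mem_Collect_eq)
  have Ck1: "(\<forall>x. \<phi> differentiable (at x)) \<and>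
      (\<forall>v. continuous_on UNIV (\<lambda>x. frechet_derivative \<phi> (at x) v))"
    using mem(1)[of "Suc 0"] unfolding Ck.simps .
  show "(\<phi> has_derivative frechet_derivative \<phi> (at x)) (at x)"
    using Ck1[THEN conjunct1, THEN spec] unfolding frechet_derivative_works .
  show "continuous_on UNIV (\<lambda>x. frechet_derivative \<phi> (at x) v)"
    using Ck1[THEN conjunct2, THEN spec] .
  show "compact (closure {x. \<phi> x \<noteq> 0})" and "closure {x. \<phi> x \<noteq> 0} \<subseteq> \<Omega>"
    by (rule mem)+
  show "x \<notin> closure {x. \<phi> x \<noteq> 0} \<Longrightarrow> \<phi> x = 0"
    using closure_subset[of "{x. \<phi> x \<noteq> 0}"] by blast
qed

text \<open>
The classical gradient is a weak gradient: the defining identity is integration by parts,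
and \<open>u\<close> and \<open>g\<close> vanish off a compact subset of \<open>\<Omega>\<close>, so that integrals over
\<open>\<Omega>\<close> are integrals over the whole space.
\<close>
lemma weak_gradient_test_function:
  fixes u :: "'a::euclidean_space \<Rightarrow> real"
  assumes u: "u \<in> test_functions \<Omega>" and "open \<Omega>" and "0 < p"
    and g: "\<And>x. (u has_derivative (\<lambda>v. g x \<bullet> v)) (at x)" and cg: "continuous_on UNIV g"
  shows "weak_gradient \<Omega> p u g"
proof -
  define K where "K = closure {x. u x \<noteq> 0}"
  have K: "compact K" "K \<subseteq> \<Omega>" and u_out: "\<And>x. x \<notin> K \<Longrightarrow> u x = 0"
    unfolding K_def by (rule test_functionsD[OF u]; assumption)+
  have g_out: "g x = 0" if "x \<notin> K" for x
    using has_derivative_eq_0_off_support[OF g compact_imp_closed[OF K(1)] u_out that, of "g x"]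
    by simp
  have cu: "continuous_on UNIV u"
    by (rule continuous_at_imp_continuous_on) (use has_derivative_continuous[OF g] in simp)
  have "(LINT x|lebesgue_on \<Omega>. u x * frechet_derivative \<phi> (at x) b)
          = - (LINT x|lebesgue_on \<Omega>. (g x \<bullet> b) * \<phi> x)"
    if \<phi>: "\<phi> \<in> test_functions \<Omega>" for \<phi> b
  proof -
    have c\<phi>: "continuous_on UNIV \<phi>"
      by (rule continuous_at_imp_continuous_on)
        (use has_derivative_continuous[OF test_functionsD(1)[OF \<phi>]] in simp)
    have cg': "continuous_on UNIV (\<lambda>x. g x \<bullet> b)" for b
      by (intro continuous_intros cg)
    have "(LINT x|lebesgue_on \<Omega>. u x * frechet_derivative \<phi> (at x) b)
        = (LINT x|lborel. u x * frechet_derivative \<phi> (at x) b)"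
    proof (rule integral_lebesgue_on_eq_lborel)
      show "(\<lambda>x. u x * frechet_derivative \<phi> (at x) b) \<in> borel_measurable borel"
        by (intro borel_measurable_continuous_onI continuous_on_mult cu test_functionsD(2)[OF \<phi>])
      show "u x * frechet_derivative \<phi> (at x) b = 0" if "x \<notin> \<Omega>" for x
      proof -
        have "x \<notin> K" using that K(2) by blast
        then show ?thesis by (simp add: u_out)
      qed
    qed (use assms(2) in simp)
    also have "\<dots> = - (LINT x|lborel. (g x \<bullet> b) * \<phi> x)"
      by (rule integration_by_parts_compact_support[OF g cg' test_functionsD(1)[OF \<phi>]
            test_functionsD(2)[OF \<phi>] K(1) u_out])
    also have "(LINT x|lborel. (g x \<bullet> b) * \<phi> x) = (LINT x|lebesgue_on \<Omega>. (g x \<bullet> b) * \<phi> x)"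
    proof (rule integral_lebesgue_on_eq_lborel(1)[symmetric])
      show "(\<lambda>x. (g x \<bullet> b) * \<phi> x) \<in> borel_measurable borel"
        by (intro borel_measurable_continuous_onI continuous_on_mult cg' c\<phi>)
      show "(g x \<bullet> b) * \<phi> x = 0" if "x \<notin> \<Omega>" for x
      proof -
        have "x \<notin> K" using that K(2) by blast
        then show ?thesis by (simp add: g_out)
      qed
    qed (use assms(2) in simp)
    finally show ?thesis .
  qed
  moreover have "in_Lp \<Omega> p g"
    by (rule in_Lp_continuous_compact_support[OF cg K(1) g_out K(2) assms(2,3)])
  ultimately show ?thesis unfolding weak_gradient_def by blast
qed

text \<open>
The function is approximated by itself, and the zero function has weak gradient zero.
\<close>
lemma test_function_in_W1_0:
  assumes u: "u \<in> test_functions \<Omega>" "in_Lp \<Omega> p u" "weak_gradient \<Omega> p u g"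
  shows "u \<in> W1_0 \<Omega> p"
proof -
  have "weak_gradient \<Omega> p (\<lambda>x. u x - u x) (\<lambda>_. 0)"
    by (simp add: weak_gradient_def in_Lp_def)
  moreover have "W1_norm \<Omega> p (\<lambda>x. u x - u x) (\<lambda>_. 0 :: 'a) = 0"
    by (simp add: W1_norm_def Lp_norm_def)
  ultimately have "\<exists>\<phi>\<in>test_functions \<Omega>. \<exists>h.
     weak_gradient \<Omega> p (\<lambda>x. u x - \<phi> x) h \<and> W1_norm \<Omega> p (\<lambda>x. u x - \<phi> x) h < \<epsilon>" if "\<epsilon> > 0" for \<epsilon>
    using that by (intro bexI[of _ u] exI[of _ "\<lambda>_. 0"] conjI u(1)) (simp_all only:)
  moreover have "u \<in> W1 \<Omega> p" unfolding W1_def using u(2,3) by blast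
  ultimately show ?thesis unfolding W1_0_def by (intro CollectI conjI allI impI)
qed

section \<open>Two-sided bounds for the norms of the bump\<close>

lemma Lp_norm_powr_eq:
  assumes "0 < p"
  shows "Lp_norm \<Omega> p f powr p = (LINT x|lebesgue_on \<Omega>. norm (f x) powr p)"
proof -
  have "0 \<le> (LINT x|lebesgue_on \<Omega>. norm (f x) powr p)" by simp
  then show ?thesis using assms by (simp add: Lp_norm_def powr_powr)
qed

lemma Lp_norm_powr_le:
  fixes f :: "'a::euclidean_space \<Rightarrow> 'b::euclidean_space"
  assumes "in_Lp \<Omega> p f" and "\<Omega> \<in> lmeasurable" and "0 < p" and "\<And>x. norm (f x) \<le> C"
  shows "Lp_norm \<Omega> p f powr p \<le> C powr p * measure lebesgue \<Omega>"
proof -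
  interpret finite_measure "lebesgue_on \<Omega>"
    using assms(2) by (rule finite_measure_lebesgue_on)
  have "(LINT x|lebesgue_on \<Omega>. norm (f x) powr p) \<le> (LINT x|lebesgue_on \<Omega>. C powr p)"
    using assms by (intro integral_mono powr_mono2) (auto simp: in_Lp_def)
  also have "\<dots> = C powr p * measure lebesgue \<Omega>"
    using assms(2) by (simp add: measure_restrict_space)
  finally show ?thesis using assms(3) by (simp add: Lp_norm_powr_eq)
qed

lemma Lp_norm_powr_ge:
  fixes f :: "'a::euclidean_space \<Rightarrow> 'b::euclidean_space"
  assumes "in_Lp \<Omega> p f" and "\<Omega> \<in> sets lebesgue" and "A \<in> lmeasurable" and "A \<subseteq> \<Omega>"
    and "0 < p" and "0 \<le> c" and "\<And>x. x \<in> A \<Longrightarrow> c \<le> norm (f x)"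
  shows "c powr p * measure lebesgue A \<le> Lp_norm \<Omega> p f powr p"
proof -
  have A: "A \<in> sets (lebesgue_on \<Omega>)"
    using assms(2,3,4) by (simp add: sets_restrict_space_iff fmeasurableD)
  have emA: "emeasure (lebesgue_on \<Omega>) A = emeasure lebesgue A"
    using assms(2,4) by (intro emeasure_restrict_space) auto
  have int_ind: "integrable (lebesgue_on \<Omega>) (indicat_real A)"
    using A emA fmeasurableD2[OF assms(3)] by (intro integrable_real_indicator) (auto simp: less_top)
  have "c powr p * measure lebesgue A = (LINT x|lebesgue_on \<Omega>. indicat_real A x * c powr p)"
    using A emA assms(4) by (simp add: measure_def Int_absorb2)
  also have "\<dots> \<le> (LINT x|lebesgue_on \<Omega>. norm (f x) powr p)"
  proof (rule integral_mono)
    show "integrable (lebesgue_on \<Omega>) (\<lambda>x. indicat_real A x * c powr p)"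
      using int_ind by (rule integrable_mult_left)
    show "integrable (lebesgue_on \<Omega>) (\<lambda>x. norm (f x) powr p)"
      using assms(1) by (simp add: in_Lp_def)
    show "indicat_real A x * c powr p \<le> norm (f x) powr p" for x
      using assms(5,6,7) by (cases "x \<in> A") (simp_all add: powr_mono2)
  qed
  finally show ?thesis using assms(5) by (simp add: Lp_norm_powr_eq)
qed

text \<open>
The bump is positive exactly on the open ball of radius \<open>r\<close>. Its support is the closed ball,
so it is a test function only on concentric balls of a radius larger than \<open>r\<close>.
\<close>
definition bump :: "'a::euclidean_space \<Rightarrow> real \<Rightarrow> 'a \<Rightarrow> real" where
  "bump x0 r x = flat_exp 0 (1 - (1 / r\<^sup>2) * ((x - x0) \<bullet> (x - x0)))"

definition bump_gradient :: "'a::euclidean_space \<Rightarrow> real \<Rightarrow> 'a \<Rightarrow> 'a" where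
  "bump_gradient x0 r x =
     (- 2 / r\<^sup>2 * flat_exp 2 (1 - (1 / r\<^sup>2) * ((x - x0) \<bullet> (x - x0)))) *\<^sub>R (x - x0)"

lemma bump_has_derivative:
  "(bump x0 r has_derivative (\<lambda>v. bump_gradient x0 r x \<bullet> v)) (at x)"
  unfolding bump_def[abs_def] bump_gradient_def
  by (rule has_derivative_eq_rhs[OF has_derivative_flat_exp_radial])
    (simp add: fun_eq_iff flip: numeral_2_eq_2)

lemma continuous_on_bump_gradient: "continuous_on UNIV (bump_gradient x0 r)"
proof -
  have "continuous_on UNIV (flat_exp 2)"
    using DERIV_isCont[OF DERIV_flat_exp] by (simp add: continuous_at_imp_continuous_on)
  then have cont: "continuous_on UNIV (\<lambda>x. flat_exp 2 (1 - c * ((x - x0) \<bullet> (x - x0))))" for c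
    by (rule continuous_on_compose2) (auto intro!: continuous_intros)
  show ?thesis
    unfolding bump_gradient_def[abs_def]
    by (intro continuous_on_scaleR continuous_on_mult_left continuous_on_diff continuous_on_const
        continuous_on_id cont)
qed

lemma radial_pos_iff:
  fixes x :: "'a::euclidean_space"
  assumes "0 < r"
  shows "0 < 1 - (1 / r\<^sup>2) * ((x - x0) \<bullet> (x - x0)) \<longleftrightarrow> x \<in> ball x0 r"
proof -
  have "0 < 1 - (1 / r\<^sup>2) * ((x - x0) \<bullet> (x - x0)) \<longleftrightarrow> (norm (x - x0))\<^sup>2 < r\<^sup>2"
    using assms by (simp add: power2_norm_eq_inner divide_simps)
  also have "\<dots> \<longleftrightarrow> norm (x - x0) < r"
    using assms power_mono_iff[of r "norm (x - x0)" 2] by (simp add: linorder_not_le[symmetric])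
  finally show ?thesis by (simp add: dist_norm norm_minus_commute)
qed

lemma bump_support: "0 < r \<Longrightarrow> {x. bump x0 r x \<noteq> 0} = ball x0 r"
  unfolding bump_def flat_exp_def by (auto simp only: radial_pos_iff) (auto split: if_splits)

lemma bump_in_test_functions:
  assumes "0 < r" and "r < R"
  shows "bump x0 r \<in> test_functions (ball x0 R)"
proof -
  have "bump_derivative x0 (1 / r\<^sup>2) (bump x0 r)"
    unfolding bump_def[abs_def] by (rule bump_derivative.flat_exp)
  then show ?thesis
    using assms bump_derivative_Ck[of x0 "1 / r\<^sup>2" "bump x0 r"] cball_subset_ball_iff[of x0 r x0 R]
    by (simp add: test_functions_def bump_support)
qed

lemma norm_bump_gradient_le:
  fixes x0 :: "'a::euclidean_space"
  assumes "0 < r"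
  shows "norm (bump_gradient x0 r x) \<le> 4 / r"
proof (cases "x \<in> ball x0 r")
  case True
  then have "norm (x - x0) \<le> r" by (simp add: dist_norm norm_minus_commute)
  have "norm (bump_gradient x0 r x)
      = 2 / r\<^sup>2 * flat_exp 2 (1 - (1 / r\<^sup>2) * ((x - x0) \<bullet> (x - x0))) * norm (x - x0)"
    by (simp add: bump_gradient_def abs_mult flat_exp_nonneg)
  also have "\<dots> \<le> 2 / r\<^sup>2 * 2 * r"
    using \<open>norm (x - x0) \<le> r\<close> assms
    by (intro mult_mono mult_left_mono flat_exp_2_le) (auto simp: flat_exp_nonneg)
  also have "\<dots> = 4 / r" using assms by (simp add: power2_eq_square)
  finally show ?thesis .
next
  case False
  then show ?thesis
    using assms unfolding bump_gradient_def flat_exp_def by (simp only: radial_pos_iff if_False) simp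
qed

text \<open>
On the half ball the argument of the profile is at least \<open>1 / 2\<close> (in fact \<open>3 / 4\<close>), which
bounds the bump below independently of \<open>r\<close>.
\<close>
lemma bump_ge:
  fixes x0 :: "'a::euclidean_space"
  assumes "0 < r" and "x \<in> ball x0 (r / 2)"
  shows "exp (- 2) \<le> bump x0 r x"
proof -
  define s where "s = 1 - (1 / r\<^sup>2) * ((x - x0) \<bullet> (x - x0))"
  have "norm (x - x0) \<le> r / 2" using assms(2) by (simp add: dist_norm norm_minus_commute)
  then have "(norm (x - x0))\<^sup>2 \<le> (r / 2)\<^sup>2" by (intro power_mono) auto
  then have "(x - x0) \<bullet> (x - x0) \<le> r\<^sup>2 / 4"
    by (simp add: power2_norm_eq_inner power_divide)
  then have "(1 / r\<^sup>2) * ((x - x0) \<bullet> (x - x0)) \<le> (1 / r\<^sup>2) * (r\<^sup>2 / 4)"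
    by (intro mult_left_mono) auto
  then have "s \<ge> 1 / 2" using assms(1)
    by (simp add: s_def divide_simps) (use inner_ge_zero[of "x - x0"] in linarith)
  then have "1 / s \<le> 2" by (simp add: divide_simps)
  then show ?thesis
    using \<open>s \<ge> 1 / 2\<close> unfolding bump_def s_def[symmetric] by (simp add: flat_exp_def)
qed

text \<open>
The competitor that makes the Rayleigh quotient small. Its gradient is at most \<open>4 / r\<close> on a
ball of radius \<open>2 * r\<close>, and its value at least \<open>exp (- 2)\<close> on a ball of radius \<open>r / 2\<close>;
with the volumes of these balls this bounds the gradient norm above and the function norm below,
in both cases with the optimal power of \<open>r\<close>.
The bound is left in the unsimplified form in which these two estimates enter.
\<close>
lemma rayleigh_quotient_of_bump:
  fixes x0 :: "'a::euclidean_space"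
  assumes "1 < p" and "1 \<le> q" and "0 < r"
  defines "d \<equiv> real DIM('a)" and "V \<equiv> unit_ball_vol (real DIM('a))"
  shows "\<exists>t\<in>rayleigh_quotients (ball x0 (2 * r)) p q.
      t \<le> ((4 / r) powr p * (V * (2 * r) powr d)) / (exp (- 2) powr q * (V * (r / 2) powr d)) powr (p / q)"
proof -
  let ?\<Omega> = "ball x0 (2 * r)" and ?u = "bump x0 r" and ?g = "bump_gradient x0 r"
  have V: "0 < V" by (simp add: V_def)
  have vol: "measure lebesgue (ball x0 \<rho>) = V * \<rho> powr d" if "0 < \<rho>" for \<rho> :: real
    using that content_ball[of \<rho> x0] by (simp add: V_def d_def powr_realpow)
  have test: "?u \<in> test_functions ?\<Omega>"
    using assms(3) by (intro bump_in_test_functions) auto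
  have grad: "weak_gradient ?\<Omega> p ?u ?g"
    using assms(1) by (intro weak_gradient_test_function test bump_has_derivative
        continuous_on_bump_gradient) auto
  have cont: "continuous_on UNIV ?u"
    using has_derivative_continuous[OF bump_has_derivative[of x0 r]]
    by (simp add: continuous_at_imp_continuous_on)
  have uLp: "in_Lp ?\<Omega> s ?u" if "0 < s" for s
    by (rule in_Lp_continuous_compact_support[OF cont test_functionsD(3)[OF test]
          test_functionsD(5)[OF test] test_functionsD(4)[OF test] open_ball that])
  have upper: "Lp_norm ?\<Omega> p ?g powr p \<le> (4 / r) powr p * (V * (2 * r) powr d)"
  proof -
    have "Lp_norm ?\<Omega> p ?g powr p \<le> (4 / r) powr p * measure lebesgue ?\<Omega>"
      by (rule Lp_norm_powr_le)
        (use grad assms(1,3) norm_bump_gradient_le in \<open>simp_all add: weak_gradient_def\<close>)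
    then show ?thesis using vol[of "2 * r"] assms(3) by (simp only: mult_pos_pos zero_less_numeral)
  qed
  \<comment> \<open>The lower bound is positive, so the bump is not almost everywhere zero.\<close>
  define B where "B = exp (- 2) powr q * (V * (r / 2) powr d)"
  have B: "0 < B" using V assms(3) by (simp add: B_def)
  have lower: "B \<le> Lp_norm ?\<Omega> q ?u powr q"
  proof -
    have "exp (- 2) powr q * measure lebesgue (ball x0 (r / 2)) \<le> Lp_norm ?\<Omega> q ?u powr q"
      by (rule Lp_norm_powr_ge)
        (use uLp assms(2,3) order_trans[OF bump_ge[OF assms(3)] abs_ge_self] in
          \<open>simp_all add: subset_ball\<close>)
    then show ?thesis unfolding B_def using vol[of "r / 2"] assms(3) by (simp only: half_gt_zero)
  qed
  have "\<not> (AE x in lebesgue_on ?\<Omega>. ?u x = 0)"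
  proof
    assume "AE x in lebesgue_on ?\<Omega>. ?u x = 0"
    then have "AE x in lebesgue_on ?\<Omega>. norm (?u x) powr q = 0" by eventually_elim simp
    then have "(LINT x|lebesgue_on ?\<Omega>. norm (?u x) powr q) = 0" by (rule integral_eq_zero_AE)
    then show False using lower B assms(2) by (simp add: Lp_norm_powr_eq)
  qed
  then have mem: "Lp_norm ?\<Omega> p ?g powr p / Lp_norm ?\<Omega> q ?u powr p
      \<in> rayleigh_quotients ?\<Omega> p q"
    unfolding rayleigh_quotients_def
    using test_function_in_W1_0[OF test uLp grad] grad uLp[of q] assms(1,2) by auto
  have "B powr (p / q) \<le> (Lp_norm ?\<Omega> q ?u powr q) powr (p / q)"
    using lower B assms(1,2) by (intro powr_mono2) auto
  also have "\<dots> = Lp_norm ?\<Omega> q ?u powr p" using assms(2) by (simp add: powr_powr)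
  finally have "Lp_norm ?\<Omega> p ?g powr p / Lp_norm ?\<Omega> q ?u powr p
      \<le> ((4 / r) powr p * (V * (2 * r) powr d)) / B powr (p / q)"
    using upper B V by (intro frac_le) auto
  with mem show ?thesis unfolding B_def by blast
qed

section \<open>The limit\<close>

lemma rayleigh_quotients_nonneg: "t \<in> rayleigh_quotients \<Omega> p q \<Longrightarrow> 0 \<le> t"
  by (auto simp: rayleigh_quotients_def)

theorem corollary4:
  fixes x0 :: "real ^ 'n" and p q N :: real
  assumes "N = real CARD('n)" and "N \<ge> 2"
    and "1 < p" and "p < N"
    and "1 \<le> q" and "q < N * p / (N - p)"
  shows "((\<lambda>R. lambda_q p q x0 R) \<longlongrightarrow> 0) at_top"
proof -
  define V where "V = unit_ball_vol N"
  define K where "K = (4 powr p * (V * 2 powr N)) / (exp (- 2) powr q * (V * (1 / 2) powr N)) powr (p / q)"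
  define e where "e = N - p - N * p / q"
  have V: "0 < V" using assms(2) by (simp add: V_def)
  \<comment> \<open>Negativity of the exponent is the subcriticality of \<open>q\<close>, rearranged.\<close>
  have e: "e < 0"
  proof -
    have "q * (N - p) < N * p" using assms by (simp add: less_divide_eq)
    then have "N - p < N * p / q" using assms(5) by (simp add: less_divide_eq mult.commute)
    then show ?thesis by (simp add: e_def)
  qed
  have bounds: "0 \<le> lambda_q p q x0 (2 * r) \<and> lambda_q p q x0 (2 * r) \<le> K * r powr e" if r: "0 < r" for r
  proof -
    obtain t where t: "t \<in> rayleigh_quotients (ball x0 (2 * r)) p q"
      and le: "t \<le> ((4 / r) powr p * (V * (2 * r) powr N))
          / (exp (- 2) powr q * (V * (r / 2) powr N)) powr (p / q)"
      using rayleigh_quotient_of_bump[OF assms(3,5) r, of x0] by (auto simp: V_def assms(1))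
    have "((4 / r) powr p * (V * (2 * r) powr N))
          / (exp (- 2) powr q * (V * (r / 2) powr N)) powr (p / q)
        = K * (r powr N / r powr p / (r powr N) powr (p / q))"
      using r V by (simp add: K_def powr_mult powr_divide field_simps)
    also have "r powr N / r powr p / (r powr N) powr (p / q) = r powr e"
      by (simp add: e_def powr_diff powr_powr)
    finally have "t \<le> K * r powr e" using le by simp
    \<comment> \<open>The infimum of an unbounded or of an empty set of reals would be unspecified.\<close>
    moreover have "bdd_below (rayleigh_quotients (ball x0 (2 * r)) p q)"
      by (rule bdd_belowI[OF rayleigh_quotients_nonneg])
    ultimately have "lambda_q p q x0 (2 * r) \<le> K * r powr e"
      unfolding lambda_q_def using cInf_lower[OF t] by linarith
    moreover have "0 \<le> lambda_q p q x0 (2 * r)"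
      unfolding lambda_q_def
      by (rule cInf_greatest) (use t rayleigh_quotients_nonneg in blast)+
    ultimately show ?thesis by simp
  qed
  have half: "filterlim (\<lambda>R::real. R / 2) at_top at_top"
    using filterlim_at_top_mult_tendsto_pos[OF tendsto_const[of "1/2::real"] _ filterlim_ident] by simp
  have "((\<lambda>R. K * (R / 2) powr e) \<longlongrightarrow> K * 0) at_top"
    by (intro tendsto_mult tendsto_const tendsto_neg_powr e half)
  then have lim: "((\<lambda>R. K * (R / 2) powr e) \<longlongrightarrow> 0) at_top" by simp
  have ev: "\<forall>\<^sub>F R in at_top. 0 \<le> lambda_q p q x0 R \<and> lambda_q p q x0 R \<le> K * (R / 2) powr e"
    using eventually_gt_at_top[of 0]
    by eventually_elim (use bounds[of "_ / 2"] in auto)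
  show ?thesis
    by (rule tendsto_sandwich[OF _ _ tendsto_const lim]) (use ev in \<open>auto elim: eventually_mono\<close>)
qed
end
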